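(* Let $I\subset\mathbb{R}$ be a nonempty open interval and let $f,h:I\to\mathbb{R}$ be smooth functions with $f(u)\neq0$ and $f'(u)^2+h'(u)^2>0$ for all $u\in I$. Let $M^2$ be the surface of revolution obtained by rotating the generatrix $u\mapsto(f(u),0,h(u))$ about the $z$-axis. Then $M^2$ admits harmonic coordinate vector fields (in the sense defined in the context) if and only if $M^2$ is a plane, a cylinder, or a cone, that is, if and only if $M^2$ is contained in one of the following: - a plane $z=a$ with $a\in\mathbb{R}$; - a cylinder $x^2+y^2=a^2$ with $a>0$; - a cone $x^2+y^2=(az+b)^2$ with $a\in\mathbb{R}\setminus\{0\}$, $b\in\mathbb{R}$.
   Context: A smooth vector field $X$ on a Riemannian manifold $(M,g)$ with Levi-Civita connection $\nabla$ is called a harmonic section if its rough Laplacian vanishes: $\Delta X=\operatorname{Tr}_g\nabla^2X=\sum_i\left(\nabla_{e_i}\nabla_{e_i}X-\nabla_{\nabla_{e_i}e_i}X\right)=0$, where $\{e_i\}$ is any local orthonormal frame. Given smooth functions $\tilde f,\tilde h$ on an open interval $\tilde I$ with $\tilde f\neq0$ and $\tilde f'^2+\tilde h'^2>0$ everywhere, the associated rotational parametrization is $\tilde\phi:\tilde I\times(0,2\pi)\to\mathbb{R}^3$, $\tilde\phi(u,v)=(\tilde f(u)\sin v,\tilde f(u)\cos v,\tilde h(u))$, and the induced (pulled back) metric is $\tilde g=(\tilde f'(u)^2+\tilde h'(u)^2)\,du^2+\tilde f(u)^2\,dv^2$ on $\tilde I\times(0,2\pi)$. The surface of revolution $M^2$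 generated by $(f,h)$ is said to admit harmonic coordinate vector fields if the generatrix can be reparametrized so that the coordinate vector fields are harmonic: there exist an open interval $\tilde I$ and a smooth diffeomorphism $\theta:\tilde I\to I$ such that, for $\tilde f=f\circ\theta$ and $\tilde h=h\circ\theta$, both coordinate vector fields $\frac{\partial}{\partial u}$ and $\frac{\partial}{\partial v}$ are harmonic sections on $(\tilde I\times(0,2\pi),\tilde g)$. *)

theory Defs
  imports "HOL-Analysis.Analysis"
begin

fun Ck_on :: "nat \<Rightarrow> 'a::real_normed_vector set \<Rightarrow> ('a \<Rightarrow> 'b::real_normed_vector) \<Rightarrow> bool" where
  "Ck_on 0 S F \<longleftrightarrow> continuous_on S F"
| "Ck_on (Suc k) S F \<longleftrightarrow> (\<forall>x\<in>S. F differentiable (at x)) \<and>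
     (\<forall>w. Ck_on k S (\<lambda>x. frechet_derivative F (at x) w))"

text \<open>Intended for finite-dimensional domains and open \<open>S\<close> only; the values of \<open>F\<close> outside
  of \<open>S\<close> are then irrelevant.\<close>

definition smooth_on :: "'a::real_normed_vector set \<Rightarrow> ('a \<Rightarrow> 'b::real_normed_vector) \<Rightarrow> bool" where
  "smooth_on S F \<longleftrightarrow> (\<forall>k. Ck_on k S F)"

definition smooth_diffeomorphism :: "real set \<Rightarrow> real set \<Rightarrow> (real \<Rightarrow> real) \<Rightarrow> bool" where
  "smooth_diffeomorphism J I \<theta> \<longleftrightarrow>
     bij_betw \<theta> J I \<and> smooth_on J \<theta> \<and> smooth_on I (inv_into J \<theta>)"

text \<open>A metric is given by its matrix \<open>g x $ i $ j\<close> in the standard coordinates, a vector field by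
  its components in the standard coordinate frame.\<close>

definition partial :: "'n::finite \<Rightarrow> (real^'n \<Rightarrow> 'b::real_normed_vector) \<Rightarrow> real^'n \<Rightarrow> 'b" where
  "partial i F x = frechet_derivative F (at x) (axis i 1)"

definition metric_inner :: "real^'n^'n \<Rightarrow> real^'n \<Rightarrow> real^'n \<Rightarrow> real" where
  "metric_inner G v w = (\<Sum>i\<in>UNIV. \<Sum>j\<in>UNIV. G $ i $ j * v $ i * w $ j)"

text \<open>\<open>christoffel g k i j\<close> is the symbol with upper index \<open>k\<close> and lower indices \<open>i\<close>, \<open>j\<close>.\<close>

definition christoffel :: "(real^'n \<Rightarrow> real^'n^'n) \<Rightarrow> 'n \<Rightarrow> 'n \<Rightarrow> 'n \<Rightarrow> real^'n \<Rightarrow> real" where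
  "christoffel g k i j x = (1/2) * (\<Sum>l\<in>UNIV. matrix_inv (g x) $ k $ l *
     (partial i (\<lambda>y. g y $ j $ l) x + partial j (\<lambda>y. g y $ i $ l) x
       - partial l (\<lambda>y. g y $ i $ j) x))"

text \<open>\<open>levi_civita g Y X\<close> is the covariant derivative of \<open>X\<close> in the direction \<open>Y\<close>.\<close>

definition levi_civita ::
    "(real^'n \<Rightarrow> real^'n^'n) \<Rightarrow> (real^'n \<Rightarrow> real^'n) \<Rightarrow> (real^'n \<Rightarrow> real^'n) \<Rightarrow> real^'n \<Rightarrow> real^'n" where
  "levi_civita g Y X x = frechet_derivative X (at x) (Y x) +
     (\<chi> k. \<Sum>i\<in>UNIV. \<Sum>j\<in>UNIV. christoffel g k i j x * Y x $ i * X x $ j)"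

definition orthonormal_frame ::
    "(real^'n) set \<Rightarrow> (real^'n \<Rightarrow> real^'n^'n) \<Rightarrow> ('n \<Rightarrow> real^'n \<Rightarrow> real^'n) \<Rightarrow> bool" where
  "orthonormal_frame U g e \<longleftrightarrow> (\<forall>i. smooth_on U (e i)) \<and>
     (\<forall>x\<in>U. \<forall>i j. metric_inner (g x) (e i x) (e j x) = (if i = j then 1 else 0))"

definition rough_laplacian ::
    "(real^'n \<Rightarrow> real^'n^'n) \<Rightarrow> ('n \<Rightarrow> real^'n \<Rightarrow> real^'n) \<Rightarrow> (real^'n \<Rightarrow> real^'n) \<Rightarrow> real^'n \<Rightarrow> real^'n" where
  "rough_laplacian g e X x =
     (\<Sum>i\<in>UNIV. levi_civita g (e i) (levi_civita g (e i) X) x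
              - levi_civita g (levi_civita g (e i) (e i)) X x)"

definition harmonic_section ::
    "(real^'n) set \<Rightarrow> (real^'n \<Rightarrow> real^'n^'n) \<Rightarrow> (real^'n \<Rightarrow> real^'n) \<Rightarrow> bool" where
  "harmonic_section D g X \<longleftrightarrow> smooth_on D X \<and>
     (\<forall>U e. open U \<and> U \<subseteq> D \<and> orthonormal_frame U g e \<longrightarrow>
        (\<forall>x\<in>U. rough_laplacian g e X x = 0))"

text \<open>The connection defined above is torsion-free and compatible with the metric; together these
  two properties characterize the Levi-Civita connection.\<close>

lemma christoffel_sym:
  assumes "\<And>y. transpose (g y) = g y"
  shows "christoffel g k i j x = christoffel g k j i x"
proof -
  have "g y $ i $ j = g y $ j $ i" for y
    using assms[of y] by (metis transpose_def vec_lambda_beta)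
  then show ?thesis by (simp add: christoffel_def add.commute)
qed

lemma christoffel_metric:
  fixes g :: "real^'n \<Rightarrow> real^'n^'n"
  assumes sym: "\<And>y. transpose (g y) = g y" and inv: "invertible (g x)"
  shows "partial k (\<lambda>y. g y $ i $ j) x =
    (\<Sum>m\<in>UNIV. christoffel g m k i x * g x $ m $ j) + (\<Sum>m\<in>UNIV. christoffel g m k j x * g x $ i $ m)"
proof -
  have s: "g y $ a $ b = g y $ b $ a" for y a b
    using sym[of y] by (metis transpose_def vec_lambda_beta)
  have one: "(\<Sum>m\<in>UNIV. g x $ c $ m * matrix_inv (g x) $ m $ l) = (if c = l then 1 else 0)" for c l
  proof -
    have "(g x ** matrix_inv (g x)) $ c $ l = mat 1 $ c $ l"
      using someI_ex[OF inv[unfolded invertible_def]] by (simp add: matrix_inv_def)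
    then show ?thesis by (simp add: matrix_matrix_mult_def mat_def)
  qed
  have low: "(\<Sum>m\<in>UNIV. g x $ c $ m * christoffel g m a b x) =
     (1/2) * (partial a (\<lambda>y. g y $ b $ c) x + partial b (\<lambda>y. g y $ a $ c) x
       - partial c (\<lambda>y. g y $ a $ b) x)" for a b c
  proof -
    define t where "t l = partial a (\<lambda>y. g y $ b $ l) x + partial b (\<lambda>y. g y $ a $ l) x
       - partial l (\<lambda>y. g y $ a $ b) x" for l
    have "(\<Sum>m\<in>UNIV. g x $ c $ m * christoffel g m a b x) =
        (\<Sum>m\<in>UNIV. \<Sum>l\<in>UNIV. (1/2) * t l * (g x $ c $ m * matrix_inv (g x) $ m $ l))"
      by (simp add: christoffel_def t_def[symmetric] sum_distrib_left sum_divide_distrib mult_ac)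
    also have "\<dots> = (\<Sum>l\<in>UNIV. (1/2) * t l * (\<Sum>m\<in>UNIV. g x $ c $ m * matrix_inv (g x) $ m $ l))"
      by (subst sum.swap) (simp only: sum_distrib_left)
    also have "\<dots> = (1/2) * t c" by (simp add: one if_distrib cong: if_cong)
    finally show ?thesis by (simp add: t_def)
  qed
  have "(\<Sum>m\<in>UNIV. christoffel g m k i x * g x $ m $ j) = (\<Sum>m\<in>UNIV. g x $ j $ m * christoffel g m k i x)"
    by (metis (no_types) mult.commute s)
  moreover have "(\<Sum>m\<in>UNIV. christoffel g m k j x * g x $ i $ m) = (\<Sum>m\<in>UNIV. g x $ i $ m * christoffel g m k j x)"
    by (metis (no_types) mult.commute)
  moreover have "partial k (\<lambda>y. g y $ j $ i) x = partial k (\<lambda>y. g y $ i $ j) x"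
    by (simp add: s[of _ i j])
  ultimately show ?thesis using low[of j k i] low[of i k j] by argo
qed

definition surface_of_revolution :: "real set \<Rightarrow> (real \<Rightarrow> real) \<Rightarrow> (real \<Rightarrow> real) \<Rightarrow> (real^3) set" where
  "surface_of_revolution I f h = {vector [f u * cos t, f u * sin t, h u] | u t. u \<in> I}"

definition rotational_param :: "(real \<Rightarrow> real) \<Rightarrow> (real \<Rightarrow> real) \<Rightarrow> real^2 \<Rightarrow> real^3" where
  "rotational_param f h x = vector [f (x$1) * sin (x$2), f (x$1) * cos (x$2), h (x$1)]"

definition rotational_domain :: "real set \<Rightarrow> (real^2) set" where
  "rotational_domain J = {x. x$1 \<in> J \<and> x$2 \<in> {0<..<2*pi}}"

definition pullback_metric :: "(real^'n \<Rightarrow> real^'m) \<Rightarrow> real^'n \<Rightarrow> real^'n^'n" where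
  "pullback_metric \<phi> x = (\<chi> i j. partial i \<phi> x \<bullet> partial j \<phi> x)"

lemma pullback_metric_rotational_param:
  assumes f: "f differentiable (at (x$1))" and h: "h differentiable (at (x$1))"
  shows "pullback_metric (rotational_param f h) x =
    vector [vector [(deriv f (x$1))\<^sup>2 + (deriv h (x$1))\<^sup>2, 0], vector [0, (f (x$1))\<^sup>2]]"
proof -
  let ?f' = "deriv f (x$1)" and ?h' = "deriv h (x$1)"
  let ?D = "\<lambda>w::real^2. vector [?f' * w$1 * sin (x$2) + f (x$1) * (cos (x$2) * w$2),
     ?f' * w$1 * cos (x$2) - f (x$1) * (sin (x$2) * w$2), ?h' * w$1] :: real^3"
  have df: "(f has_field_derivative ?f') (at (x$1))" "(h has_field_derivative ?h') (at (x$1))"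
    using f h by (simp_all add: DERIV_deriv_iff_real_differentiable)
  have nth: "((\<lambda>y::real^2. y$i) has_derivative (\<lambda>w. w$i)) (at x)" for i
    by (intro bounded_linear_imp_has_derivative bounded_linear_vec_nth)
  have f1: "((\<lambda>y::real^2. f (y$1)) has_derivative (\<lambda>w. ?f' * w$1)) (at x)"
    using has_derivative_compose[OF nth[of 1] df(1)[unfolded has_field_derivative_def]] by simp
  have h1: "((\<lambda>y::real^2. h (y$1)) has_derivative (\<lambda>w. ?h' * w$1)) (at x)"
    using has_derivative_compose[OF nth[of 1] df(2)[unfolded has_field_derivative_def]] by simp
  have "(rotational_param f h has_derivative ?D) (at x)"
  proof (subst has_derivative_componentwise_within, intro ballI)
    fix b :: "real^3" assume "b \<in> Basis"
    then obtain i where b: "b = axis i 1" by (auto simp: Basis_vec_def)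
    have "((\<lambda>y. rotational_param f h y $ i) has_derivative (\<lambda>w. ?D w $ i)) (at x)"
      using exhaust_3[of i]
    proof (elim disjE)
      assume i: "i = 1"
      show ?thesis unfolding i rotational_param_def vector_3
        by (rule has_derivative_eq_rhs, rule has_derivative_mult[OF f1 has_derivative_sin[OF nth[of 2]]])
          (auto simp: algebra_simps)
    next
      assume i: "i = 2"
      show ?thesis unfolding i rotational_param_def vector_3
        by (rule has_derivative_eq_rhs, rule has_derivative_mult[OF f1 has_derivative_cos[OF nth[of 2]]])
          (auto simp: algebra_simps)
    next
      assume i: "i = 3"
      show ?thesis unfolding i rotational_param_def vector_3 by (rule h1)
    qed
    then show "((\<lambda>y. rotational_param f h y \<bullet> b) has_derivative (\<lambda>w. ?D w \<bullet> b)) (at x)"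
      by (simp add: b inner_axis)
  qed
  then have D: "frechet_derivative (rotational_param f h) (at x) = ?D"
    by (simp add: frechet_derivative_at[symmetric])
  have sc: "sin (x$2) * sin (x$2) = 1 - cos (x$2) * cos (x$2)"
    using sin_cos_squared_add3[of "x$2"] by linarith
  show ?thesis
    by (auto simp: vec_eq_iff forall_2 pullback_metric_def partial_def D inner_vec_def sum_3 vector_3
        vector_2 axis_def power2_eq_square algebra_simps sc)
qed

text \<open>The constant field \<open>axis i 1\<close> is the \<open>i\<close>-th coordinate vector field.\<close>

definition admits_harmonic_coordinate_fields ::
    "real set \<Rightarrow> (real \<Rightarrow> real) \<Rightarrow> (real \<Rightarrow> real) \<Rightarrow> bool" where
  "admits_harmonic_coordinate_fields I f h \<longleftrightarrow>
     (\<exists>J \<theta>. open J \<and> is_interval J \<and> smooth_diffeomorphism J I \<theta> \<and>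
        (\<forall>i. harmonic_section (rotational_domain J)
               (pullback_metric (rotational_param (f \<circ> \<theta>) (h \<circ> \<theta>))) (\<lambda>x. axis i 1)))"

end

theory Submission
  imports Defs
begin

text \<open>For a metric \<open>E(u) du\<^sup>2 + G(u) dv\<^sup>2\<close> put \<open>A = E'/2E\<close> and \<open>C = G'/2G\<close>. Then \<open>\<partial>/\<partial>v\<close> is
  harmonic iff \<open>C' = C (A - C)\<close>, and \<open>\<partial>/\<partial>u\<close> is harmonic iff \<open>A' = C (C - A)\<close>. On a surface of
  revolution the first equation reads \<open>f'' = A f'\<close>: the tangent of the generatrix makes a constant
  angle with the axis, so the generatrix lies on a line. Conversely, a generatrix on a line becomes
  a solution of both equations in the parameter \<open>h\<close> (cylinder) or \<open>f\<^sup>2\<close> (plane, cone).\<close>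

section \<open>Calculus of smooth functions\<close>

text \<open>For \<open>G = f^2\<close> one has \<open>C = f'/f\<close> and
  \<open>C' + C^2 = f''/f\<close>; this is why the angular equation becomes linear in
  \<open>f'\<close>. The parameters of the converse come from adding the two equations:
  \<open>A' + C' = 0\<close>, so \<open>A + C\<close> must be constant. The value 0 means that
  \<open>E * G\<close> is constant, that is, that the parameter measures area. On a line
  \<open>f'\<close> is a constant multiple of the speed, so an area parameter is affine in
  \<open>f^2\<close> when \<open>f\<close> varies and affine in \<open>h\<close> when
  \<open>f\<close> is constant. Harmonicity speaks of every local orthonormal frame. The Laplacian
  is therefore computed for an arbitrary frame: the derivatives of the frame cancel, and the
  remaining sums of products of its components are the entries of the inverse metric. Conversely, to
  extract an equation from harmonicity some frame must be exhibited, and its smoothness is where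
  square roots and reciprocals enter the calculus below.\<close>

lemma Ck_on_cong:
  assumes "open S" "\<And>x. x \<in> S \<Longrightarrow> F x = G x" "Ck_on k S F"
  shows "Ck_on k S G"
  using assms(2,3)
proof (induction k arbitrary: F G)
  case 0
  then show ?case using continuous_on_cong by (metis Ck_on.simps(1))
next
  case (Suc k)
  have D: "F differentiable (at x)" if "x \<in> S" for x
    using Suc.prems(2) that by simp
  have "(G has_derivative frechet_derivative F (at x)) (at x)" if "x \<in> S" for x
    using has_derivative_transform_within_open[OF _ \<open>open S\<close> that, of F _ UNIV G]
      D[OF that] Suc.prems(1) by (auto simp: frechet_derivative_works)
  then have G: "G differentiable (at x)" "frechet_derivative F (at x) = frechet_derivative G (at x)"
    if "x \<in> S" for x
    using that frechet_derivative_at differentiable_def by blast+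
  have "Ck_on k S (\<lambda>x. frechet_derivative G (at x) w)" for w
    using Suc.IH[of "\<lambda>x. frechet_derivative F (at x) w"] G(2) Suc.prems(2) by simp
  then show ?case using G(1) by simp
qed

text \<open>\<open>Ck_on\<close> speaks of the chosen \<open>frechet_derivative\<close>. This rule
  admits an explicit derivative \<open>D\<close> prescribed on \<open>S\<close> only, which is
  legitimate because \<open>S\<close> is open.\<close>

lemma Ck_on_SucI:
  assumes "open S" "\<And>x. x \<in> S \<Longrightarrow> (F has_derivative D x) (at x)" "\<And>w. Ck_on k S (\<lambda>x. D x w)"
  shows "Ck_on (Suc k) S F"
proof -
  have "frechet_derivative F (at x) = D x" if "x \<in> S" for x
    using assms(2)[OF that] by (simp add: frechet_derivative_at[symmetric])
  then have "Ck_on k S (\<lambda>x. frechet_derivative F (at x) w)" for w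
    using Ck_on_cong[OF assms(1) _ assms(3)[of w]] by simp
  then show ?thesis using assms(2) by (auto simp: differentiable_def)
qed

lemma Ck_on_bounded_linear:
  assumes "bounded_linear L" "open S" "Ck_on k S F"
  shows "Ck_on k S (\<lambda>x. L (F x))"
  using assms(3)
proof (induction k arbitrary: F)
  case 0
  then show ?case
    using bounded_linear.continuous_on[OF assms(1)] by simp
next
  case (Suc k)
  show ?case
  proof (rule Ck_on_SucI[OF \<open>open S\<close>])
    show "((\<lambda>x. L (F x)) has_derivative (\<lambda>w. L (frechet_derivative F (at x) w))) (at x)"
      if "x \<in> S" for x
      using Suc.prems that
      by (intro bounded_linear.has_derivative[OF assms(1)]) (simp add: frechet_derivative_works)
    show "Ck_on k S (\<lambda>x. L (frechet_derivative F (at x) w))" for w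
      using Suc by simp
  qed
qed

lemma Ck_on_const: "Ck_on k S (\<lambda>x. c)"
proof (induction k arbitrary: c)
  case (Suc k)
  have "frechet_derivative (\<lambda>x. c) (at x) = (\<lambda>w. 0)" for x :: 'a
    by (simp add: frechet_derivative_const)
  then show ?case using Suc[of 0] by simp
qed simp

text \<open>The recursion mentions only derivatives, so the descent ends at the fact that
  differentiability implies continuity. It serves the product and chain rules, whose derivatives
  contain undifferentiated factors.\<close>

lemma Ck_on_Suc_imp_Ck_on:
  "Ck_on (Suc k) S F \<Longrightarrow> Ck_on k S F"
proof (induction k arbitrary: F)
  case 0
  then show ?case
    by (auto intro!: continuous_at_imp_continuous_on differentiable_imp_continuous_within)
next
  case (Suc k)
  then show ?case using Ck_on.simps(2) by blast
qed

lemma Ck_on_add: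
  assumes "open S" "Ck_on k S F" "Ck_on k S G"
  shows "Ck_on k S (\<lambda>x. F x + G x)"
  using assms(2,3)
proof (induction k arbitrary: F G)
  case 0
  then show ?case by (auto intro: continuous_on_add)
next
  case (Suc k)
  show ?case
  proof (rule Ck_on_SucI[OF \<open>open S\<close>])
    show "((\<lambda>x. F x + G x) has_derivative
        (\<lambda>w. frechet_derivative F (at x) w + frechet_derivative G (at x) w)) (at x)"
      if "x \<in> S" for x
      using Suc.prems that by (intro has_derivative_add) (simp_all add: frechet_derivative_works)
    show "Ck_on k S (\<lambda>x. frechet_derivative F (at x) w + frechet_derivative G (at x) w)" for w
      using Suc by simp
  qed
qed

text \<open>In one variable the derivative in direction \<open>w\<close> is \<open>D x * w\<close>,
  so the quantifier over directions reduces to the single function \<open>D\<close>.\<close>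

lemma Ck_on_real_SucI:
  fixes F :: "real \<Rightarrow> real"
  assumes "open S" "\<And>x. x \<in> S \<Longrightarrow> (F has_field_derivative D x) (at x)" "Ck_on k S D"
  shows "Ck_on (Suc k) S F"
  using assms Ck_on_bounded_linear[OF bounded_linear_mult_left assms(1,3)]
  by (intro Ck_on_SucI[where D = "\<lambda>x w. D x * w"]) (auto simp: has_field_derivative_def)

lemma Ck_on_real_SucD:
  fixes F :: "real \<Rightarrow> real"
  assumes "open S" "Ck_on (Suc k) S F"
  shows "\<And>x. x \<in> S \<Longrightarrow> (F has_field_derivative deriv F x) (at x)" "Ck_on k S (deriv F)"
proof -
  show D: "(F has_field_derivative deriv F x) (at x)" if "x \<in> S" for x
    using assms that by (simp add: DERIV_deriv_iff_real_differentiable)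
  have "frechet_derivative F (at x) 1 = deriv F x" if "x \<in> S" for x
    using frechet_derivative_at[OF D[OF that, unfolded has_field_derivative_def]]
    by (metis mult.right_neutral)
  moreover have "Ck_on k S (\<lambda>x. frechet_derivative F (at x) 1)"
    using assms(2) by simp
  ultimately show "Ck_on k S (deriv F)"
    by (rule Ck_on_cong[OF assms(1)])
qed

lemma Ck_on_real_mult:
  fixes F G :: "real \<Rightarrow> real"
  assumes "open S" "Ck_on k S F" "Ck_on k S G"
  shows "Ck_on k S (\<lambda>x. F x * G x)"
  using assms(2,3)
proof (induction k arbitrary: F G)
  case 0
  then show ?case by (auto intro: continuous_on_mult)
next
  case (Suc k)
  note F = Ck_on_real_SucD[OF \<open>open S\<close> Suc.prems(1)] and G = Ck_on_real_SucD[OF \<open>open S\<close> Suc.prems(2)]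
  show ?case
  proof (rule Ck_on_real_SucI[OF \<open>open S\<close>])
    show "((\<lambda>x. F x * G x) has_field_derivative deriv F x * G x + deriv G x * F x) (at x)"
      if "x \<in> S" for x
      using F(1)[OF that] G(1)[OF that] by (rule DERIV_mult)
    show "Ck_on k S (\<lambda>x. deriv F x * G x + deriv G x * F x)"
      using F(2) G(2) Suc.prems[THEN Ck_on_Suc_imp_Ck_on]
      by (intro Ck_on_add[OF \<open>open S\<close>] Suc.IH)
  qed
qed

lemma Ck_on_real_compose:
  fixes F \<theta> :: "real \<Rightarrow> real"
  assumes "open S" "open T" "\<theta> ` T \<subseteq> S" "Ck_on k S F" "Ck_on k T \<theta>"
  shows "Ck_on k T (\<lambda>x. F (\<theta> x))"
  using assms(4,5)
proof (induction k arbitrary: F)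
  case 0
  then show ?case using assms(3) continuous_on_compose2[of S F T \<theta>] by simp
next
  case (Suc k)
  note F = Ck_on_real_SucD[OF \<open>open S\<close> Suc.prems(1)] and th = Ck_on_real_SucD[OF \<open>open T\<close> Suc.prems(2)]
  show ?case
  proof (rule Ck_on_real_SucI[OF \<open>open T\<close>])
    show "((\<lambda>x. F (\<theta> x)) has_field_derivative deriv F (\<theta> x) * deriv \<theta> x) (at x)"
      if "x \<in> T" for x
      using F(1) th(1)[OF that] assms(3) that by (intro DERIV_chain2) auto
    show "Ck_on k T (\<lambda>x. deriv F (\<theta> x) * deriv \<theta> x)"
      using Ck_on_real_mult[OF \<open>open T\<close> Suc.IH[OF F(2)] th(2)] Suc.prems(2)[THEN Ck_on_Suc_imp_Ck_on]
      by blast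
  qed
qed

lemma open_nonzero: "open {x::real. x \<noteq> 0}"
  by (intro open_Collect_neq continuous_intros)

text \<open>The derivative is a polynomial in \<open>inverse\<close> itself, so regularity of order
  \<open>k\<close> yields order \<open>Suc k\<close>. Square roots and inverse functions are
  bootstrapped in the same way.\<close>

lemma Ck_on_inverse: "Ck_on k {x::real. x \<noteq> 0} inverse"
proof (induction k)
  case 0
  then show ?case by (simp add: continuous_on_inverse)
next
  case (Suc k)
  show ?case
  proof (rule Ck_on_real_SucI[OF open_nonzero])
    show "(inverse has_field_derivative (- 1) * (inverse x * inverse x)) (at x)" if "x \<in> {x. x \<noteq> 0}" for x :: real
      using that by (auto intro!: derivative_eq_intros)
    show "Ck_on k {x::real. x \<noteq> 0} (\<lambda>x. (- 1) * (inverse x * inverse x))"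
      by (intro Ck_on_real_mult open_nonzero Ck_on_const Suc)
  qed
qed

lemma Ck_on_real_inverse:
  fixes F :: "real \<Rightarrow> real"
  assumes "open S" "Ck_on k S F" "\<And>x. x \<in> S \<Longrightarrow> F x \<noteq> 0"
  shows "Ck_on k S (\<lambda>x. inverse (F x))"
  by (rule Ck_on_real_compose[OF open_nonzero assms(1) _ Ck_on_inverse assms(2)]) (auto simp: assms(3))

section \<open>Passage from finite order to smooth functions\<close>

lemma smooth_on_realD:
  fixes F :: "real \<Rightarrow> real"
  assumes "open S" "smooth_on S F"
  shows "\<And>x. x \<in> S \<Longrightarrow> (F has_field_derivative deriv F x) (at x)" "smooth_on S (deriv F)"
  using assms Ck_on_real_SucD[OF assms(1)] unfolding smooth_on_def by blast+

lemma smooth_on_compose: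
  fixes F \<theta> :: "real \<Rightarrow> real"
  assumes "open S" "open T" "\<theta> ` T \<subseteq> S" "smooth_on S F" "smooth_on T \<theta>"
  shows "smooth_on T (F \<circ> \<theta>)"
  using assms Ck_on_real_compose[OF assms(1-3)] by (simp add: smooth_on_def comp_def)

lemma smooth_on_power2:
  fixes F :: "real \<Rightarrow> real"
  assumes "open S" "smooth_on S F"
  shows "smooth_on S (\<lambda>x. (F x)\<^sup>2)"
  using assms Ck_on_real_mult by (auto simp: smooth_on_def power2_eq_square)

lemma smooth_on_add:
  assumes "open S" "smooth_on S F" "smooth_on S G"
  shows "smooth_on S (\<lambda>x. F x + G x)"
  using assms Ck_on_add unfolding smooth_on_def by blast

lemma smooth_on_real_inverse:
  fixes F :: "real \<Rightarrow> real"
  assumes "open S" "smooth_on S F" "\<And>x. x \<in> S \<Longrightarrow> F x \<noteq> 0"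
  shows "smooth_on S (\<lambda>x. inverse (F x))"
  using assms Ck_on_real_inverse by (auto simp: smooth_on_def)

lemma smooth_on_sqrt:
  fixes F :: "real \<Rightarrow> real"
  assumes "open S" "smooth_on S F" "\<And>x. x \<in> S \<Longrightarrow> F x > 0"
  shows "smooth_on S (\<lambda>x. sqrt (F x))"
proof -
  have pos: "Ck_on k {x. x > 0} sqrt" for k
  proof (induction k)
    case 0
    then show ?case by (simp add: continuous_on_real_sqrt)
  next
    case (Suc k)
    show ?case
    proof (rule Ck_on_real_SucI)
      show "open {x::real. x > 0}" by (simp add: open_Collect_less)
      show "(sqrt has_field_derivative (1/2) * inverse (sqrt x)) (at x)" if "x \<in> {x. x > 0}" for x :: real
        using that by (auto intro!: derivative_eq_intros)
      show "Ck_on k {x::real. x > 0} (\<lambda>x. (1/2) * inverse (sqrt x))"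
        using Suc by (intro Ck_on_real_mult Ck_on_real_inverse Ck_on_const) (auto simp: open_Collect_less)
    qed
  qed
  show ?thesis
    unfolding smooth_on_def
  proof
    fix k
    show "Ck_on k S (\<lambda>x. sqrt (F x))"
      using assms Ck_on_real_compose[OF _ assms(1) _ pos[of k], of F]
      by (auto simp: open_Collect_less smooth_on_def)
  qed
qed

text \<open>Turns one-variable smoothness into smoothness of a vector field depending on one
  coordinate. The vector \<open>a\<close> is arbitrary so that the induction can absorb the factor
  \<open>w$i\<close> that differentiation produces.\<close>

lemma Ck_on_component_scaleR:
  fixes F :: "real \<Rightarrow> real" and a :: "'b::real_normed_vector" and i :: "'n::finite"
  assumes "open S" "Ck_on k S F"
  shows "Ck_on k {x :: real^'n. x$i \<in> S} (\<lambda>x. F (x$i) *\<^sub>R a)"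
  using assms(2)
proof (induction k arbitrary: F a)
  case 0
  have "continuous_on {x :: real^'n. x$i \<in> S} (\<lambda>x. F (x$i))"
    using 0 continuous_on_compose2[of S F "{x :: real^'n. x$i \<in> S}" "\<lambda>x. x$i"]
    by (auto simp: continuous_on_component)
  then show ?case
    by (simp add: continuous_on_scaleR)
next
  case (Suc k)
  note F = Ck_on_real_SucD[OF \<open>open S\<close> Suc.prems]
  have o: "open {x :: real^'n. x$i \<in> S}"
    using continuous_open_vimage[OF \<open>open S\<close>, of "\<lambda>x :: real^'n. x$i"]
    by (simp add: vimage_def continuous_on_component open_vimage_vec_nth)
  show ?case
  proof (rule Ck_on_SucI[OF o])
    show "((\<lambda>x. F (x$i) *\<^sub>R a) has_derivative (\<lambda>w. deriv F (x$i) *\<^sub>R (w$i *\<^sub>R a))) (at x)"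
      if "x \<in> {x. x$i \<in> S}" for x :: "real^'n"
    proof -
      have "((\<lambda>x. F (x$i)) has_derivative (\<lambda>w. deriv F (x$i) * w$i)) (at x)"
        using has_derivative_compose[OF bounded_linear_imp_has_derivative[OF bounded_linear_vec_nth[of i]]
            F(1)[unfolded has_field_derivative_def]] that by auto
      from has_derivative_scaleR_left[OF this, of a] show ?thesis by simp
    qed
    show "Ck_on k {x. x$i \<in> S} (\<lambda>x. deriv F (x$i) *\<^sub>R (w$i *\<^sub>R a))" for w :: "real^'n"
      by (intro Suc.IH F)
  qed
qed

text \<open>By Rolle, a derivative without zeros on an interval forces injectivity. The inverse then
  has derivative \<open>1 / F'\<close> evaluated at the inverse itself, so its regularity climbs by
  induction. This is the source of all reparametrizations below.\<close>

lemma smooth_diffeomorphism_inv_into: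
  fixes F :: "real \<Rightarrow> real"
  assumes "open I" "is_interval I" "smooth_on I F" "\<And>x. x \<in> I \<Longrightarrow> deriv F x \<noteq> 0"
  shows "open (F ` I)" "is_interval (F ` I)" "smooth_diffeomorphism (F ` I) I (inv_into I F)"
proof -
  let ?\<theta> = "inv_into I F"
  note F = smooth_on_realD[OF assms(1,3)]
  have cont: "continuous_on I F"
    using F(1) by (meson DERIV_isCont continuous_at_imp_continuous_on)
  have "F x \<noteq> F y" if "x < y" "x \<in> I" "y \<in> I" for x y
  proof
    assume eq: "F x = F y"
    have sub: "{x..y} \<subseteq> I"
      using that assms(2) by (meson atLeastAtMost_iff mem_is_interval_1_I subsetI)
    have "\<exists>z>x. z < y \<and> deriv F z = 0"
    proof -
      have "(F has_real_derivative deriv F z) (at z)" if "x \<le> z" "z \<le> y" for z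
        using that sub by (intro F(1)) auto
      from MVT2[OF \<open>x < y\<close> this] show ?thesis using eq \<open>x < y\<close> by auto
    qed
    then show False using assms(4) sub by (meson atLeastAtMost_iff less_imp_le subsetD)
  qed
  then have inj: "inj_on F I" by (metis inj_onI linorder_neqE)
  show op: "open (F ` I)"
    using invariance_of_domain[OF cont assms(1) inj] .
  show "is_interval (F ` I)"
    using connected_continuous_image[OF cont] assms(2) by (simp add: is_interval_connected_1)
  have D: "(?\<theta> has_field_derivative inverse (deriv F (?\<theta> y))) (at y)" if y: "y \<in> F ` I" for y
  proof -
    obtain x where x: "x \<in> I" "y = F x" using y by blast
    have "(?\<theta> has_field_derivative inverse (deriv F x)) (at (F x))"
      unfolding has_field_derivative_def
    proof (rule has_derivative_inverse_strong[OF assms(1) x(1) cont])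
      show "?\<theta> (F z) = z" if "z \<in> I" for z
        using inj that by simp
      show "(F has_derivative (*) (deriv F x)) (at x)"
        using F(1)[OF x(1)] by (simp add: has_field_derivative_def)
      show "(*) (deriv F x) \<circ> (*) (inverse (deriv F x)) = id"
        using assms(4)[OF x(1)] by (simp add: fun_eq_iff)
    qed
    then show ?thesis using x inj by simp
  qed
  have "Ck_on k (F ` I) ?\<theta>" for k
  proof (induction k)
    case 0
    show ?case by (simp add: continuous_at_imp_continuous_on D[THEN DERIV_isCont])
  next
    case (Suc k)
    show ?case
    proof (rule Ck_on_real_SucI[OF op D])
      show "Ck_on k (F ` I) (\<lambda>y. inverse (deriv F (?\<theta> y)))"
      proof (rule Ck_on_real_inverse[OF op])
        show "Ck_on k (F ` I) (\<lambda>y. deriv F (?\<theta> y))"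
          using F(2) inj by (intro Ck_on_real_compose[OF assms(1) op _ _ Suc]) (auto simp: smooth_on_def)
        show "deriv F (?\<theta> y) \<noteq> 0" if "y \<in> F ` I" for y
          using assms(4) inj that by auto
      qed
    qed
  qed
  \<comment> \<open>The inverse of the inverse agrees with \<open>F\<close> on \<open>I\<close>, and
    on an open set this is enough to inherit regularity.\<close>
  moreover have "Ck_on k I (inv_into (F ` I) ?\<theta>)" for k
  proof (rule Ck_on_cong[OF assms(1)])
    show "F x = inv_into (F ` I) ?\<theta> x" if "x \<in> I" for x
      using inv_into_f_f[OF inj_on_inv_into[OF subset_refl], of "F x" F I] inj that by simp
    show "Ck_on k I F" using assms(3) by (simp add: smooth_on_def)
  qed
  ultimately show "smooth_diffeomorphism (F ` I) I ?\<theta>"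
    using bij_betw_inv_into[OF inj_on_imp_bij_betw[OF inj]]
    by (simp add: smooth_diffeomorphism_def smooth_on_def)
qed

lemma Ck_on_subset: "Ck_on k S F \<Longrightarrow> T \<subseteq> S \<Longrightarrow> Ck_on k T F"
proof (induction k arbitrary: F)
  case 0
  then show ?case by (simp add: continuous_on_subset)
next
  case (Suc k)
  then show ?case unfolding Ck_on.simps by blast
qed

section \<open>The rough Laplacian of a metric depending on one coordinate\<close>

text \<open>\<open>matrix_inv\<close> is given by a choice; multiplying its left inverse law by the
  explicit right inverse identifies the chosen matrix.\<close>

lemma matrix_inv_diagonal_2:
  assumes "a \<noteq> 0" "b \<noteq> (0::real)"
  shows "matrix_inv (vector [vector [a, 0], vector [0, b]] :: real^2^2) =
    vector [vector [1 / a, 0], vector [0, 1 / b]]" (is "matrix_inv ?M = ?N")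
proof -
  have MN: "?M ** ?N = mat 1" "?N ** ?M = mat 1"
    using assms by (simp_all add: matrix_matrix_mult_def mat_def vec_eq_iff forall_2 sum_2)
  then have "invertible ?M" by (auto simp: invertible_def)
  then have "matrix_inv ?M ** ?M = mat 1"
    using someI_ex[of "\<lambda>A'. ?M ** A' = mat 1 \<and> A' ** ?M = mat 1"]
    by (simp add: invertible_def matrix_inv_def)
  then have "matrix_inv ?M ** ?M ** ?N = ?N" by (simp add: matrix_mul_lid)
  then show ?thesis
    unfolding matrix_mul_assoc[symmetric] MN(1) matrix_mul_rid .
qed

lemma has_derivative_vector_2:
  assumes "(f has_derivative f') F" "(g has_derivative g') F"
  shows "((\<lambda>y. vector [f y, g y] :: real^2) has_derivative (\<lambda>w. vector [f' w, g' w])) F"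
proof -
  have v: "vector [a, b] = a *\<^sub>R axis 1 1 + b *\<^sub>R (axis 2 1 :: real^2)" for a b :: real
    by (simp add: vec_eq_iff forall_2 axis_def)
  show ?thesis unfolding v
    by (intro has_derivative_add has_derivative_scaleR_left assms)
qed

lemma has_derivative_field_component:
  fixes F :: "real \<Rightarrow> real" and x :: "real^'n"
  assumes "(F has_field_derivative D) (at (x$i))"
  shows "((\<lambda>y. F (y$i)) has_derivative (\<lambda>w. D * w$i)) (at x)"
  using has_derivative_compose[OF bounded_linear_imp_has_derivative[OF bounded_linear_vec_nth]
      assms[unfolded has_field_derivative_def]] by simp

text \<open>The frame matrix \<open>M\<close> satisfies \<open>M g M\<^sup>T = 1\<close>; a one-sided inverse of a square matrix is two-sided.\<close>

lemma orthonormal_frame_sum: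
  fixes g :: "real^'n \<Rightarrow> real^'n^'n"
  assumes "orthonormal_frame U g e" "x \<in> U"
  shows "(\<Sum>i\<in>UNIV. (\<Sum>c\<in>UNIV. g x $ a $ c * e i x $ c) * e i x $ b) = (if a = b then 1 else 0)"
proof -
  define M :: "real^'n^'n" where "M = (\<chi> i. e i x)"
  have "M ** (g x ** transpose M) = mat 1"
    using assms unfolding orthonormal_frame_def metric_inner_def
    by (simp add: M_def matrix_matrix_mult_def transpose_def mat_def vec_eq_iff sum_distrib_left mult_ac)
  then have "(g x ** transpose M) ** M = mat 1"
    using matrix_left_right_inverse by blast
  then have "((g x ** transpose M) ** M) $ a $ b = mat 1 $ a $ b" by simp
  then show ?thesis
    by (simp add: M_def matrix_matrix_mult_def transpose_def mat_def)
qed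

text \<open>\<open>A\<close> and \<open>C\<close> are half the logarithmic derivatives of
  \<open>E\<close> and \<open>G\<close>. In this form they are themselves the Christoffel symbols
  with indices (1;11) and (2;12), so no quotient remains in the covariant derivatives except in
  \<open>B\<close>.\<close>

locale warped_metric =
  fixes U :: "(real^2) set" and g :: "real^2 \<Rightarrow> real^2^2"
    and E G A C A' C' :: "real \<Rightarrow> real"
  assumes open_U: "open U"
    and g: "x \<in> U \<Longrightarrow> g x = vector [vector [E (x$1), 0], vector [0, G (x$1)]]"
    and pos: "x \<in> U \<Longrightarrow> E (x$1) > 0" "x \<in> U \<Longrightarrow> G (x$1) > 0"
    and E: "x \<in> U \<Longrightarrow> (E has_field_derivative 2 * E (x$1) * A (x$1)) (at (x$1))"
    and G: "x \<in> U \<Longrightarrow> (G has_field_derivative 2 * G (x$1) * C (x$1)) (at (x$1))"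
    and A: "x \<in> U \<Longrightarrow> (A has_field_derivative A' (x$1)) (at (x$1))"
    and C: "x \<in> U \<Longrightarrow> (C has_field_derivative C' (x$1)) (at (x$1))"
begin

text \<open>The remaining nonzero Christoffel symbol (1;22), classically
  \<open>- G' / (2 * E)\<close>.\<close>

definition B :: "real \<Rightarrow> real" where
  "B u = - (G u * C u / E u)"

text \<open>No formula for the derivative is recorded: in the Laplacian it is multiplied by the sum
  of \<open>p * q\<close> over the frame, which vanishes because the inverse metric is
  diagonal.\<close>

lemma B:
  assumes "x \<in> U"
  obtains B' where "(B has_field_derivative B') (at (x$1))"
proof -
  have "((\<lambda>u. - (G u * C u / E u)) has_field_derivative
      - (((2 * G (x$1) * C (x$1) * C (x$1) + C' (x$1) * G (x$1)) * E (x$1)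
        - G (x$1) * C (x$1) * (2 * E (x$1) * A (x$1))) / (E (x$1) * E (x$1)))) (at (x$1))"
    using pos(1)[OF assms]
    by (intro DERIV_minus DERIV_divide DERIV_mult E G C assms) simp
  then show thesis using that unfolding B_def[abs_def] by blast
qed

text \<open>\<open>axis i 1 $ 1\<close> acts as the Kronecker delta of \<open>i\<close> and 1. The
  entries are known on \<open>U\<close> only; openness carries the derivative over to
  \<open>g\<close>.\<close>

lemma partial_entry:
  assumes "x \<in> U"
  shows "partial i (\<lambda>y. g y $ 1 $ 1) x = 2 * E (x$1) * A (x$1) * axis i 1 $ 1"
    "partial i (\<lambda>y. g y $ 2 $ 2) x = 2 * G (x$1) * C (x$1) * axis i 1 $ 1"
    "partial i (\<lambda>y. g y $ 1 $ 2) x = 0" "partial i (\<lambda>y. g y $ 2 $ 1) x = 0"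
proof -
  have *: "partial i \<phi> x = D * axis i 1 $ 1"
    if "(F has_field_derivative D) (at (x$1))" "\<And>y. y \<in> U \<Longrightarrow> F (y$1) = \<phi> y" for F D and \<phi> :: "real^2 \<Rightarrow> real"
    using has_derivative_transform_within_open[OF has_derivative_field_component[OF that(1)] open_U assms that(2)]
    by (simp add: partial_def frechet_derivative_at[symmetric])
  show "partial i (\<lambda>y. g y $ 1 $ 1) x = 2 * E (x$1) * A (x$1) * axis i 1 $ 1"
    by (rule *[OF E[OF assms]]) (simp add: g)
  show "partial i (\<lambda>y. g y $ 2 $ 2) x = 2 * G (x$1) * C (x$1) * axis i 1 $ 1"
    by (rule *[OF G[OF assms]]) (simp add: g)
  have 0: "((\<lambda>u. 0) has_field_derivative 0) (at (x$1))" by simp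
  show "partial i (\<lambda>y. g y $ 1 $ 2) x = 0" "partial i (\<lambda>y. g y $ 2 $ 1) x = 0"
    using *[OF 0, of "\<lambda>y. g y $ 1 $ 2"] *[OF 0, of "\<lambda>y. g y $ 2 $ 1"] by (simp_all add: g)
qed

lemma christoffel:
  assumes "x \<in> U"
  shows "christoffel g 1 1 1 x = A (x$1)" "christoffel g 1 2 2 x = B (x$1)"
    "christoffel g 2 1 2 x = C (x$1)" "christoffel g 2 2 1 x = C (x$1)"
    "christoffel g 1 1 2 x = 0" "christoffel g 1 2 1 x = 0"
    "christoffel g 2 1 1 x = 0" "christoffel g 2 2 2 x = 0"
  using pos[OF assms]
  by (simp_all add: christoffel_def sum_2 partial_entry[OF assms] g[OF assms] matrix_inv_diagonal_2
      axis_def B_def)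

lemma levi_civita:
  assumes "x \<in> U"
  shows "levi_civita g Y X x = frechet_derivative X (at x) (Y x) +
    vector [A (x$1) * Y x $ 1 * X x $ 1 + B (x$1) * Y x $ 2 * X x $ 2,
      C (x$1) * (Y x $ 1 * X x $ 2 + Y x $ 2 * X x $ 1)]"
  by (simp add: levi_civita_def sum_2 christoffel[OF assms] vec_eq_iff forall_2 algebra_simps)

text \<open>The summand of the rough Laplacian belonging to the frame vector \<open>e\<close> is the second covariant
  derivative evaluated on \<open>(e, e)\<close>; the derivatives of \<open>e\<close> cancel.\<close>

lemma second_covariant_derivative:
  fixes e :: "real^2 \<Rightarrow> real^2"
  assumes x: "x \<in> U" and e: "e differentiable (at x)" and B': "(B has_field_derivative B') (at (x$1))"
  defines "p \<equiv> e x $ 1" and "q \<equiv> e x $ 2" and "u \<equiv> x $ 1"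
  shows "levi_civita g e (levi_civita g e (\<lambda>y. axis 1 1)) x
      - levi_civita g (levi_civita g e e) (\<lambda>y. axis 1 1) x =
    vector [A' u * p\<^sup>2 + B u * (C u - A u) * q\<^sup>2, (C' u + A u * C u - (C u)\<^sup>2) * (p * q)]"
    (is "?L1 = _")
    "levi_civita g e (levi_civita g e (\<lambda>y. axis 2 1)) x
      - levi_civita g (levi_civita g e e) (\<lambda>y. axis 2 1) x =
    vector [(B' + A u * B u - B u * C u) * (p * q), (C' u + (C u)\<^sup>2 - A u * C u) * p\<^sup>2]"
    (is "?L2 = _")
proof -
  define De where "De = frechet_derivative e (at x)"
  have e': "(e has_derivative De) (at x)"
    using e by (simp add: De_def frechet_derivative_works)
  have ei: "((\<lambda>y. e y $ i) has_derivative (\<lambda>w. De w $ i)) (at x)" for i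
    using bounded_linear.has_derivative[OF bounded_linear_vec_nth e'] .
  note AC = has_derivative_field_component[OF A[OF x]] has_derivative_field_component[OF C[OF x]]
    has_derivative_field_component[OF B']
  have Z1: "levi_civita g e (\<lambda>y. axis 1 1) y = vector [A (y$1) * e y $ 1, C (y$1) * e y $ 2]"
    and Z2: "levi_civita g e (\<lambda>y. axis 2 1) y = vector [B (y$1) * e y $ 2, C (y$1) * e y $ 1]"
    if "y \<in> U" for y e
    by (simp_all add: levi_civita[OF that] axis_def vec_eq_iff forall_2)
  have D1: "frechet_derivative (levi_civita g e (\<lambda>y. axis 1 1)) (at x) =
    (\<lambda>w. vector [A u * De w $ 1 + A' u * w$1 * p, C u * De w $ 2 + C' u * w$1 * q])"
    using has_derivative_transform_within_open[OF has_derivative_vector_2[OF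
        has_derivative_mult[OF AC(1) ei[of 1]] has_derivative_mult[OF AC(2) ei[of 2]]] open_U x]
    by (auto simp: Z1 p_def q_def u_def intro!: frechet_derivative_at[symmetric])
  have D2: "frechet_derivative (levi_civita g e (\<lambda>y. axis 2 1)) (at x) =
    (\<lambda>w. vector [B u * De w $ 2 + B' * w$1 * q, C u * De w $ 1 + C' u * w$1 * p])"
    using has_derivative_transform_within_open[OF has_derivative_vector_2[OF
        has_derivative_mult[OF AC(3) ei[of 2]] has_derivative_mult[OF AC(2) ei[of 1]]] open_U x]
    by (auto simp: Z2 p_def q_def u_def intro!: frechet_derivative_at[symmetric])
  have ee: "levi_civita g e e x = De (e x) +
      vector [A u * p * p + B u * q * q, C u * (p * q + q * p)]"
    by (simp add: levi_civita[OF x] De_def p_def q_def u_def)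
  have outer: "levi_civita g e Z x = frechet_derivative Z (at x) (e x) +
      vector [A u * p * Z x $ 1 + B u * q * Z x $ 2, C u * (p * Z x $ 2 + q * Z x $ 1)]" for Z
    by (simp add: levi_civita[OF x] p_def q_def u_def)
  show "?L1 = vector [A' u * p\<^sup>2 + B u * (C u - A u) * q\<^sup>2, (C' u + A u * C u - (C u)\<^sup>2) * (p * q)]"
    by (simp add: outer D1 Z1[OF x] ee flip: p_def q_def u_def De_def)
      (simp add: vec_eq_iff forall_2 algebra_simps power2_eq_square)
  show "?L2 = vector [(B' + A u * B u - B u * C u) * (p * q), (C' u + (C u)\<^sup>2 - A u * C u) * p\<^sup>2]"
    by (simp add: outer D2 Z2[OF x] ee flip: p_def q_def u_def De_def)
      (simp add: vec_eq_iff forall_2 algebra_simps power2_eq_square)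
qed

text \<open>Summed over the frame, \<open>p^2\<close>, \<open>q^2\<close> and \<open>p * q\<close>
  give the entries \<open>1 / E\<close>, \<open>1 / G\<close> and 0 of the inverse metric. Hence the
  result does not depend on the frame, and each coordinate field has a Laplacian proportional to
  itself.\<close>

lemma rough_laplacian:
  assumes V: "V \<subseteq> U" "orthonormal_frame V g e" "x \<in> V"
  defines "u \<equiv> x $ 1"
  shows "rough_laplacian g e (\<lambda>y. axis 1 1) x =
      vector [(A' u - C u * (C u - A u)) / E u, 0]"
    "rough_laplacian g e (\<lambda>y. axis 2 1) x =
      vector [0, (C' u + (C u)\<^sup>2 - A u * C u) / E u]"
proof -
  have x: "x \<in> U" using V by blast
  obtain B' where B': "(B has_field_derivative B') (at (x$1))" using B[OF x] .
  have "Ck_on (Suc 0) V (e i)" for i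
    using V(2) unfolding orthonormal_frame_def smooth_on_def by blast
  then have e: "e i differentiable (at x)" for i
    using V(3) by simp
  define p q where "p i = e i x $ 1" and "q i = e i x $ 2" for i
  note S = orthonormal_frame_sum[OF V(2,3)]
  have P: "E u > 0" "G u > 0" using pos[OF x] by (simp_all add: u_def)
  have pp: "(p 1)\<^sup>2 + (p 2)\<^sup>2 = 1 / E u" and qq: "(q 1)\<^sup>2 + (q 2)\<^sup>2 = 1 / G u"
    using S[of 1 1] S[of 2 2] P
    by (simp_all add: sum_2 g[OF x] p_def q_def u_def field_simps power2_eq_square)
  have "E u * (p 1 * q 1 + p 2 * q 2) = 0"
    using S[of 1 2] by (simp add: sum_2 g[OF x] p_def q_def u_def algebra_simps)
  then have pq: "p 1 * q 1 + p 2 * q 2 = 0"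
    using P by simp
  have lin: "a * p 1 ^ 2 + b * q 1 ^ 2 + (a * p 2 ^ 2 + b * q 2 ^ 2) = a / E u + b / G u"
    "a * (p 1 * q 1) + a * (p 2 * q 2) = 0"
    "a * p 1 ^ 2 + a * p 2 ^ 2 = a / E u" for a b
  proof -
    have "a * p 1 ^ 2 + b * q 1 ^ 2 + (a * p 2 ^ 2 + b * q 2 ^ 2) =
        a * ((p 1)\<^sup>2 + (p 2)\<^sup>2) + b * ((q 1)\<^sup>2 + (q 2)\<^sup>2)" by algebra
    then show "a * p 1 ^ 2 + b * q 1 ^ 2 + (a * p 2 ^ 2 + b * q 2 ^ 2) = a / E u + b / G u"
      by (simp add: pp qq)
    show "a * (p 1 * q 1) + a * (p 2 * q 2) = 0" "a * p 1 ^ 2 + a * p 2 ^ 2 = a / E u"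
      using pp pq by (simp_all flip: distrib_left)
  qed
  note T = second_covariant_derivative[OF x e B', folded p_def q_def u_def]
  \<comment> \<open>Since \<open>B / G = - C / E\<close>, the contribution of the second diagonal
    entry acquires the denominator \<open>E\<close> of the first.\<close>
  have B: "B u * c / G u = - (C u * c / E u)" for c
    using P by (simp add: B_def)
  show "rough_laplacian g e (\<lambda>y. axis 1 1) x = vector [(A' u - C u * (C u - A u)) / E u, 0]"
    by (simp add: rough_laplacian_def sum_2 T(1)) (simp add: vec_eq_iff forall_2 lin B diff_divide_distrib)
  show "rough_laplacian g e (\<lambda>y. axis 2 1) x = vector [0, (C' u + (C u)\<^sup>2 - A u * C u) / E u]"
    by (simp add: rough_laplacian_def sum_2 T(2)) (simp add: vec_eq_iff forall_2 lin)
qed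

end

section \<open>Harmonic fields on a surface of revolution\<close>

lemma open_rotational_domain: "open J \<Longrightarrow> open (rotational_domain J)"
proof -
  assume "open J"
  then have "open ((\<lambda>x :: real^2. x$1) -` J \<inter> (\<lambda>x. x$2) -` {0<..<2*pi})"
    by (intro open_Int open_vimage_vec_nth) auto
  then show ?thesis
    by (simp add: rotational_domain_def vimage_def Int_def)
qed

context warped_metric
begin

lemma harmonic_coordinate_field:
  assumes "\<And>x. x \<in> U \<Longrightarrow> A' (x$1) = C (x$1) * (C (x$1) - A (x$1))"
    and "\<And>x. x \<in> U \<Longrightarrow> C' (x$1) = C (x$1) * (A (x$1) - C (x$1))"
  shows "harmonic_section U g (\<lambda>x. axis i 1)"
  unfolding harmonic_section_def
proof (intro conjI allI impI ballI)
  show "smooth_on U (\<lambda>x. axis i (1::real))"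
    by (simp add: smooth_on_def Ck_on_const)
next
  fix V e x assume V: "open V \<and> V \<subseteq> U \<and> orthonormal_frame V g e" "x \<in> V"
  then have "x \<in> U" by blast
  then show "rough_laplacian g e (\<lambda>x. axis i 1) x = 0"
    using rough_laplacian[of V e x] V assms[of x] exhaust_2[of i]
    by (auto simp: vec_eq_iff forall_2 algebra_simps power2_eq_square)
qed

lemma harmonic_angular_field_imp:
  assumes "harmonic_section U g (\<lambda>x. axis 2 1)" and "orthonormal_frame U g e" and "x \<in> U"
  shows "C' (x$1) + (C (x$1))\<^sup>2 = A (x$1) * C (x$1)"
proof -
  have "rough_laplacian g e (\<lambda>x. axis 2 1) x = 0"
    using assms open_U unfolding harmonic_section_def by blast
  then show ?thesis
    using rough_laplacian(2)[OF subset_refl assms(2,3)] pos(1)[OF assms(3)]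
    by (simp add: vec_eq_iff forall_2)
qed

end

text \<open>Normalizing the coordinate fields gives a frame on all of \<open>U\<close>. Without a
  frame the universally quantified condition in \<open>harmonic_section\<close> could hold vacuously
  and would yield no equation.\<close>

lemma exists_orthonormal_frame_diagonal:
  fixes E G :: "real \<Rightarrow> real"
  assumes J: "open J" and E: "smooth_on J E" "\<And>u. u \<in> J \<Longrightarrow> E u > 0"
    and G: "smooth_on J G" "\<And>u. u \<in> J \<Longrightarrow> G u > 0"
    and U: "\<And>x. x \<in> U \<Longrightarrow> x$1 \<in> J"
    and g: "\<And>x. x \<in> U \<Longrightarrow> g x = vector [vector [E (x$1), 0], vector [0, G (x$1)]]"
  shows "\<exists>e. orthonormal_frame U (g :: real^2 \<Rightarrow> real^2^2) e"
proof -
  define e :: "2 \<Rightarrow> real^2 \<Rightarrow> real^2" where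
    "e i x = inverse (sqrt (if i = 1 then E (x$1) else G (x$1))) *\<^sub>R axis i 1" for i x
  have "Ck_on k U (\<lambda>x. inverse (sqrt (F (x$1))) *\<^sub>R axis i (1::real))"
    if "smooth_on J F" "\<And>u. u \<in> J \<Longrightarrow> F u > 0" for k and i :: 2 and F :: "real \<Rightarrow> real"
  proof (rule Ck_on_subset)
    have "smooth_on J (\<lambda>u. inverse (sqrt (F u)))"
      using that(2) by (intro smooth_on_real_inverse smooth_on_sqrt J that(1)) fastforce+
    then show "Ck_on k {x :: real^2. x$1 \<in> J} (\<lambda>x. inverse (sqrt (F (x$1))) *\<^sub>R axis i 1)"
      using Ck_on_component_scaleR[OF J] unfolding smooth_on_def by blast
    show "U \<subseteq> {x. x$1 \<in> J}" using U by blast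
  qed
  from this[OF E] this[OF G] have "smooth_on U (e i)" for i
    unfolding smooth_on_def e_def by (cases "i = 1") simp_all
  moreover have "metric_inner (g x) (e i x) (e j x) = (if i = j then 1 else 0)" if "x \<in> U" for x i j
  proof -
    have "E (x$1) > 0" "G (x$1) > 0" using E(2) G(2) U[OF that] by blast+
    then show ?thesis
      using exhaust_2[of i] exhaust_2[of j]
      by (auto simp: metric_inner_def sum_2 g[OF that] e_def axis_def field_simps)
  qed
  ultimately have "orthonormal_frame U g e" by (simp add: orthonormal_frame_def)
  then show ?thesis by blast
qed

lemma pullback_metric_rotational_param_DERIV:
  assumes "(f has_field_derivative a) (at (x$1))" "(h has_field_derivative b) (at (x$1))"
  shows "pullback_metric (rotational_param f h) x =
    vector [vector [a\<^sup>2 + b\<^sup>2, 0], vector [0, (f (x$1))\<^sup>2]]"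
proof -
  have "f differentiable (at (x$1))" "h differentiable (at (x$1))"
    using assms by (auto simp: real_differentiable_def)
  from pullback_metric_rotational_param[OF this] show ?thesis
    by (simp add: DERIV_imp_deriv[OF assms(1)] DERIV_imp_deriv[OF assms(2)])
qed

section \<open>From harmonicity of the angular field to a straight generatrix\<close>

lemma interval_constant_if_DERIV_zero:
  fixes F :: "real \<Rightarrow> real"
  assumes "is_interval J" "\<And>u. u \<in> J \<Longrightarrow> (F has_field_derivative 0) (at u)"
  obtains c where "\<And>u. u \<in> J \<Longrightarrow> F u = c"
  using has_field_derivative_zero_constant[of J F] assms
  by (metis is_interval_convex has_field_derivative_at_within)

text \<open>Harmonicity of \<open>\<partial>/\<partial>v\<close> says that \<open>f'' = A f'\<close>, where \<open>A = W'/W\<close> for the speed \<open>W\<close> of the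
  generatrix. So \<open>f'/W\<close> is constant, and \<open>h'/W\<close>, whose square is \<open>1 - (f'/W)\<^sup>2\<close>, is constant
  by continuity.\<close>

lemma harmonic_angular_field_imp_linear_relation:
  fixes f h :: "real \<Rightarrow> real"
  assumes J: "open J" "is_interval J" "J \<noteq> {}" and f: "smooth_on J f" and h: "smooth_on J h"
    and f0: "\<And>u. u \<in> J \<Longrightarrow> f u \<noteq> 0"
    and reg: "\<And>u. u \<in> J \<Longrightarrow> (deriv f u)\<^sup>2 + (deriv h u)\<^sup>2 > 0"
    and harm: "harmonic_section (rotational_domain J) (pullback_metric (rotational_param f h)) (\<lambda>x. axis 2 1)"
  obtains k l c where "k \<noteq> 0 \<or> l \<noteq> 0" "\<And>u. u \<in> J \<Longrightarrow> l * f u = k * h u + c"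
proof -
  let ?U = "rotational_domain J" and ?g = "pullback_metric (rotational_param f h)"
  define E where "E u = (deriv f u)\<^sup>2 + (deriv h u)\<^sup>2" for u
  define f'' h'' where "f'' = deriv (deriv f)" and "h'' = deriv (deriv h)"
  define A where "A u = (deriv f u * f'' u + deriv h u * h'' u) / E u" for u
  note f1 = smooth_on_realD[OF J(1) f] and h1 = smooth_on_realD[OF J(1) h]
  note f2 = smooth_on_realD[OF J(1) f1(2), folded f''_def]
    and h2 = smooth_on_realD[OF J(1) h1(2), folded h''_def]
  note f3 = smooth_on_realD(1)[OF J(1) f2(2)] and h3 = smooth_on_realD(1)[OF J(1) h2(2)]
  have Epos: "E u > 0" if "u \<in> J" for u
    using reg[OF that] by (simp add: E_def)
  have E': "(E has_field_derivative 2 * E u * A u) (at u)" if "u \<in> J" for u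
  proof -
    have "(E has_field_derivative 2 * deriv f u * f'' u + 2 * deriv h u * h'' u) (at u)"
      unfolding E_def[abs_def]
      using f2(1)[OF that] h2(1)[OF that] by (auto intro!: derivative_eq_intros)
    moreover have "2 * deriv f u * f'' u + 2 * deriv h u * h'' u = 2 * E u * A u"
      using Epos[OF that] by (simp add: A_def)
    ultimately show ?thesis by simp
  qed
  have A': "(A has_field_derivative deriv A u) (at u)" if "u \<in> J" for u
  proof -
    have "A differentiable (at u)"
      unfolding A_def[abs_def]
      using f2(1)[OF that] h2(1)[OF that] f3[OF that] h3[OF that] E'[OF that] Epos[OF that]
      by (intro differentiable_divide differentiable_add differentiable_mult)
        (auto simp: real_differentiable_def)
    then show ?thesis by (simp add: DERIV_deriv_iff_real_differentiable)
  qed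
  have dom: "x$1 \<in> J" if "x \<in> ?U" for x
    using that by (simp add: rotational_domain_def)
  interpret warped_metric ?U ?g E "\<lambda>u. (f u)\<^sup>2" A "\<lambda>u. deriv f u / f u" "deriv A"
    "\<lambda>u. (f'' u * f u - deriv f u * deriv f u) / (f u * f u)"
  proof
    show "open ?U" by (rule open_rotational_domain[OF J(1)])
    fix x assume "x \<in> ?U"
    note x = dom[OF this]
    show "?g x = vector [vector [E (x$1), 0], vector [0, (f (x$1))\<^sup>2]]"
      using pullback_metric_rotational_param_DERIV[OF f1(1)[OF x] h1(1)[OF x]] by (simp add: E_def)
    show "E (x$1) > 0" "(f (x$1))\<^sup>2 > 0" using Epos[OF x] f0[OF x] by simp_all
    show "(E has_field_derivative 2 * E (x$1) * A (x$1)) (at (x$1))" by (rule E'[OF x])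
    show "(A has_field_derivative deriv A (x$1)) (at (x$1))" by (rule A'[OF x])
    show "((\<lambda>u. (f u)\<^sup>2) has_field_derivative 2 * (f (x$1))\<^sup>2 * (deriv f (x$1) / f (x$1))) (at (x$1))"
      using f1(1)[OF x] f0[OF x]
      by (auto intro!: derivative_eq_intros simp: power2_eq_square)
    show "((\<lambda>u. deriv f u / f u) has_field_derivative
        (f'' (x$1) * f (x$1) - deriv f (x$1) * deriv f (x$1)) / (f (x$1) * f (x$1))) (at (x$1))"
      using DERIV_divide[OF f2(1)[OF x] f1(1)[OF x] f0[OF x]] .
  qed
  have "smooth_on J E"
    unfolding E_def[abs_def] by (intro smooth_on_add smooth_on_power2 J f1 h1)
  then obtain e where e: "orthonormal_frame ?U ?g e"
    using exists_orthonormal_frame_diagonal[OF J(1) _ Epos smooth_on_power2[OF J(1) f] _ dom g] f0 by auto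
  have f''A: "f'' u = A u * deriv f u" if "u \<in> J" for u
  proof -
    \<comment> \<open>The equation involves the first coordinate only, so any angle in the domain
      serves; \<open>pi\<close> is its midpoint.\<close>
    have "vector [u, pi] \<in> ?U" using that by (simp add: rotational_domain_def)
    from harmonic_angular_field_imp[OF harm e this] show ?thesis
      using f0[OF that] by (simp add: field_simps power2_eq_square)
  qed
  define k where "k u = deriv f u / sqrt (E u)" for u
  define l where "l u = deriv h u / sqrt (E u)" for u
  have W': "((\<lambda>u. sqrt (E u)) has_field_derivative A u * sqrt (E u)) (at u)" if "u \<in> J" for u
  proof -
    have "((\<lambda>u. sqrt (E u)) has_field_derivative inverse (sqrt (E u)) / 2 * (2 * E u * A u)) (at u)"
      by (rule DERIV_chain2[OF DERIV_real_sqrt[OF Epos[OF that]] E'[OF that]])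
    moreover have "inverse (sqrt (E u)) / 2 * (2 * E u * A u) = A u * sqrt (E u)"
      using Epos[OF that] by (simp add: field_simps flip: power2_eq_square)
    ultimately show ?thesis by (rule DERIV_cong)
  qed
  have "(k has_field_derivative 0) (at u)" if "u \<in> J" for u
    using DERIV_divide[OF f2(1)[OF that] W'[OF that]] Epos[OF that] f''A[OF that]
    by (simp add: k_def[abs_def])
  then obtain k0 where k0: "\<And>u. u \<in> J \<Longrightarrow> k u = k0"
    using interval_constant_if_DERIV_zero[OF J(2)] by blast
  have kl: "(k u)\<^sup>2 + (l u)\<^sup>2 = 1" if "u \<in> J" for u
  proof -
    have "(k u)\<^sup>2 + (l u)\<^sup>2 = E u / E u"
      using Epos[OF that]
      by (simp add: k_def l_def power_divide add_divide_distrib[symmetric] E_def[of u, symmetric])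
    then show ?thesis using Epos[OF that] by simp
  qed
  \<comment> \<open>Only the square of \<open>l\<close> is known, which leaves two possible values;
    a continuous function with finite range on a connected set is constant.\<close>
  have "l u \<in> {sqrt (1 - k0\<^sup>2), - sqrt (1 - k0\<^sup>2)}" if "u \<in> J" for u
  proof -
    have "(l u)\<^sup>2 = 1 - k0\<^sup>2" using kl[OF that] k0[OF that] by simp
    then have "sqrt (1 - k0\<^sup>2) = \<bar>l u\<bar>" by (metis real_sqrt_abs)
    then show ?thesis by auto
  qed
  then have "finite (l ` J)"
    by (intro finite_subset[OF _ finite.insertI[OF finite.insertI[OF finite.emptyI]]]) blast
  moreover have "continuous_on J l"
  proof (rule continuous_at_imp_continuous_on, rule ballI)
    show "isCont l u" if "u \<in> J" for u
      using DERIV_divide[OF h2(1)[OF that] W'[OF that]] Epos[OF that]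
      unfolding l_def[abs_def] by (intro DERIV_isCont) auto
  qed
  ultimately have "l constant_on J"
    using continuous_finite_range_constant J(2) is_interval_connected by blast
  then obtain l0 where l0: "\<And>u. u \<in> J \<Longrightarrow> l u = l0"
    by (auto simp: constant_on_def)
  \<comment> \<open>The unit tangent is \<open>(k0, l0)\<close>, so the generatrix has constant
    scalar product with the normal \<open>(l0, - k0)\<close>.\<close>
  have "((\<lambda>u. l0 * f u - k0 * h u) has_field_derivative 0) (at u)" if "u \<in> J" for u
  proof -
    have "((\<lambda>u. l0 * f u - k0 * h u) has_field_derivative l0 * deriv f u - k0 * deriv h u) (at u)"
      using f1(1)[OF that] h1(1)[OF that] by (intro DERIV_diff DERIV_cmult)
    moreover have "l0 * deriv f u - k0 * deriv h u = 0"
      using k0[OF that, symmetric] l0[OF that, symmetric] by (simp add: k_def l_def)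
    ultimately show ?thesis by simp
  qed
  then obtain c where "\<And>u. u \<in> J \<Longrightarrow> l0 * f u - k0 * h u = c"
    using interval_constant_if_DERIV_zero[OF J(2)] by blast
  then have "l0 * f u = k0 * h u + c" if "u \<in> J" for u
    using that by (metis diff_add_cancel add.commute)
  \<comment> \<open>A unit vector is nonzero; the identity \<open>kl\<close> is read at one point of
    the nonempty \<open>J\<close>.\<close>
  moreover have "k0 \<noteq> 0 \<or> l0 \<noteq> 0"
  proof -
    obtain u where "u \<in> J" using J(3) by blast
    then show ?thesis using kl k0 l0 by force
  qed
  ultimately show thesis using that by blast
qed

text \<open>The chain rule for the smooth inverse composed with \<theta> makes the product of the
  two derivatives equal to 1.\<close>

lemma deriv_diffeomorphism_nonzero:
  assumes "open J" "open I" "smooth_diffeomorphism J I \<theta>" "u \<in> J"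
  shows "deriv \<theta> u \<noteq> 0"
proof -
  have bij: "bij_betw \<theta> J I" and s: "smooth_on J \<theta>" "smooth_on I (inv_into J \<theta>)"
    using assms(3) by (simp_all add: smooth_diffeomorphism_def)
  have tu: "\<theta> u \<in> I" using bij assms(4) bij_betwE by blast
  have "((\<lambda>v. inv_into J \<theta> (\<theta> v)) has_field_derivative deriv (inv_into J \<theta>) (\<theta> u) * deriv \<theta> u) (at u)"
    by (rule DERIV_chain2[OF smooth_on_realD(1)[OF assms(2) s(2) tu] smooth_on_realD(1)[OF assms(1) s(1) assms(4)]])
  then have "((\<lambda>v. v) has_field_derivative deriv (inv_into J \<theta>) (\<theta> u) * deriv \<theta> u) (at u)"
    using has_field_derivative_transform_within_open[OF _ assms(1,4)] bij
    by (metis (no_types, lifting) bij_betw_inv_into_left)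
  then have "deriv (inv_into J \<theta>) (\<theta> u) * deriv \<theta> u = 1"
    using DERIV_unique DERIV_ident by blast
  then show ?thesis by auto
qed

text \<open>Rotation leaves \<open>x^2 + y^2 = f^2\<close> and \<open>z = h\<close>, so containment
  is a condition on the generatrix. A constant \<open>Q\<close> gives cylinders, the square of an
  affine \<open>Q\<close> gives cones.\<close>

lemma surface_of_revolution_subset_iff:
  "surface_of_revolution I f h \<subseteq> {p. (p$1)\<^sup>2 + (p$2)\<^sup>2 = Q (p$3)} \<longleftrightarrow> (\<forall>u\<in>I. (f u)\<^sup>2 = Q (h u))"
  "surface_of_revolution I f h \<subseteq> {p. p$3 = a} \<longleftrightarrow> (\<forall>u\<in>I. h u = a)"
proof -
  have "(f u * cos t)\<^sup>2 + (f u * sin t)\<^sup>2 = (f u)\<^sup>2" for u t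
    by (simp add: power_mult_distrib flip: distrib_left)
  then show "surface_of_revolution I f h \<subseteq> {p. (p$1)\<^sup>2 + (p$2)\<^sup>2 = Q (p$3)} \<longleftrightarrow> (\<forall>u\<in>I. (f u)\<^sup>2 = Q (h u))"
    unfolding surface_of_revolution_def by (simp add: subset_iff) (metis vector_3)
  show "surface_of_revolution I f h \<subseteq> {p. p$3 = a} \<longleftrightarrow> (\<forall>u\<in>I. h u = a)"
    unfolding surface_of_revolution_def by (simp add: subset_iff) (metis vector_3)
qed

section \<open>Reparametrization of the generatrix\<close>

context
  fixes I :: "real set" and f h :: "real \<Rightarrow> real"
  assumes I: "open I" "is_interval I" and f: "smooth_on I f" and h: "smooth_on I h"
    and f0: "\<And>u. u \<in> I \<Longrightarrow> f u \<noteq> 0"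
    and reg: "\<And>u. u \<in> I \<Longrightarrow> (deriv f u)\<^sup>2 + (deriv h u)\<^sup>2 > 0"
begin

lemma smooth_on_reparametrization:
  assumes "open J" "smooth_diffeomorphism J I \<theta>"
  shows "smooth_on J (f \<circ> \<theta>)" "smooth_on J (h \<circ> \<theta>)"
proof -
  have "\<theta> ` J \<subseteq> I" "smooth_on J \<theta>"
    using assms(2) by (auto simp: smooth_diffeomorphism_def bij_betw_def)
  then show "smooth_on J (f \<circ> \<theta>)" "smooth_on J (h \<circ> \<theta>)"
    using smooth_on_compose[OF I(1) assms(1)] f h by blast+
qed

text \<open>Regularity passes to the new parameter because the squared speed is multiplied by the
  nonzero square of the derivative of \<theta>. The relation obtained there concerns values only and
  returns to \<open>I\<close> because \<theta> is onto.\<close>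

lemma linear_relation_if_admits_harmonic_coordinate_fields:
  assumes "I \<noteq> {}" "admits_harmonic_coordinate_fields I f h"
  obtains k l c where "k \<noteq> 0 \<or> l \<noteq> 0" "\<And>u. u \<in> I \<Longrightarrow> l * f u = k * h u + c"
proof -
  obtain J \<theta> where J: "open J" "is_interval J" and th: "smooth_diffeomorphism J I \<theta>"
    and harm: "harmonic_section (rotational_domain J)
      (pullback_metric (rotational_param (f \<circ> \<theta>) (h \<circ> \<theta>))) (\<lambda>x. axis 2 1)"
    using assms(2) unfolding admits_harmonic_coordinate_fields_def by blast
  have im: "\<theta> ` J = I" and s: "smooth_on J \<theta>"
    using th by (simp_all add: smooth_diffeomorphism_def bij_betw_def)
  have "(deriv (f \<circ> \<theta>) u)\<^sup>2 + (deriv (h \<circ> \<theta>) u)\<^sup>2 > 0" if "u \<in> J" for u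
  proof -
    have t: "\<theta> u \<in> I" using im that by blast
    have "deriv (F \<circ> \<theta>) u = deriv F (\<theta> u) * deriv \<theta> u" if "smooth_on I F" for F
      using DERIV_chain[OF smooth_on_realD(1)[OF I(1) that t] smooth_on_realD(1)[OF J(1) s \<open>u \<in> J\<close>]]
      by (rule DERIV_imp_deriv)
    then have "(deriv (f \<circ> \<theta>) u)\<^sup>2 + (deriv (h \<circ> \<theta>) u)\<^sup>2 =
        ((deriv f (\<theta> u))\<^sup>2 + (deriv h (\<theta> u))\<^sup>2) * (deriv \<theta> u)\<^sup>2"
      using f h by (simp add: power_mult_distrib distrib_right)
    then show ?thesis
      using reg[OF t] deriv_diffeomorphism_nonzero[OF J(1) I(1) th that] by simp
  qed
  moreover have "(f \<circ> \<theta>) u \<noteq> 0" if "u \<in> J" for u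
    using f0 im that by auto
  moreover have "J \<noteq> {}" using assms(1) im by blast
  ultimately obtain k l c where kl: "k \<noteq> 0 \<or> l \<noteq> 0"
    and lin: "\<And>u. u \<in> J \<Longrightarrow> l * (f \<circ> \<theta>) u = k * (h \<circ> \<theta>) u + c"
    using harmonic_angular_field_imp_linear_relation[OF J _ smooth_on_reparametrization[OF J(1) th] _ _ harm]
    by blast
  have "l * f u = k * h u + c" if "u \<in> I" for u
    using lin that im by fastforce
  with kl show thesis using that by blast
qed

text \<open>Differentiating \<open>f^2 = r\<close> gives \<open>f' = 0\<close>, so regularity leaves
  \<open>h'\<close> without zeros and \<open>h\<close> can serve as parameter. The metric becomes
  \<open>du^2 + r dv^2\<close>, with \<open>A = C = 0\<close>.\<close>

lemma admits_harmonic_coordinate_fields_if_cylinder: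
  assumes "\<And>u. u \<in> I \<Longrightarrow> (f u)\<^sup>2 = r"
  shows "admits_harmonic_coordinate_fields I f h"
proof -
  note f1 = smooth_on_realD(1)[OF I(1) f]
  have f': "deriv f u = 0" if "u \<in> I" for u
  proof -
    have "((\<lambda>u. (f u)\<^sup>2) has_field_derivative 2 * f u * deriv f u) (at u)"
      using f1[OF that] by (auto intro!: derivative_eq_intros)
    moreover have "((\<lambda>u. (f u)\<^sup>2) has_field_derivative 0) (at u)"
      using has_field_derivative_transform_within_open[OF DERIV_const I(1) that, of r "\<lambda>u. (f u)\<^sup>2"] assms
      by simp
    ultimately show ?thesis using DERIV_unique f0[OF that] by fastforce
  qed
  then have h': "deriv h u \<noteq> 0" if "u \<in> I" for u
    using reg[OF that] that by auto
  define J \<theta> where "J = h ` I" and "\<theta> = inv_into I h"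
  have J: "open J" "is_interval J" "smooth_diffeomorphism J I \<theta>"
    unfolding J_def \<theta>_def using smooth_diffeomorphism_inv_into[OF I h] h' by blast+
  have dom: "x$1 \<in> J" if "x \<in> rotational_domain J" for x
    using that by (simp add: rotational_domain_def)
  have th: "\<theta> u \<in> I" "h (\<theta> u) = u" if "u \<in> J" for u
    using that by (auto simp: J_def \<theta>_def inv_into_into f_inv_into_f)
  have "smooth_on J \<theta>" using J(3) by (simp add: smooth_diffeomorphism_def)
  note th1 = smooth_on_realD(1)[OF J(1) this]
  have fth: "((f \<circ> \<theta>) has_field_derivative 0) (at u)" if "u \<in> J" for u
    using DERIV_chain[OF f1[OF th(1)[OF that]] th1[OF that]] f' th(1) that by simp
  have hth: "((h \<circ> \<theta>) has_field_derivative 1) (at u)" if "u \<in> J" for u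
    using has_field_derivative_transform_within_open[OF DERIV_ident J(1) that, of "h \<circ> \<theta>"] th(2) by simp
  have r: "r > 0" if "u \<in> I" for u
    using assms[OF that] f0[OF that] by (metis zero_less_power2)
  interpret warped_metric "rotational_domain J" "pullback_metric (rotational_param (f \<circ> \<theta>) (h \<circ> \<theta>))"
    "\<lambda>u. 1" "\<lambda>u. r" "\<lambda>u. 0" "\<lambda>u. 0" "\<lambda>u. 0" "\<lambda>u. 0"
  proof
    show "open (rotational_domain J)" by (rule open_rotational_domain[OF J(1)])
    fix x assume "x \<in> rotational_domain J"
    note x = dom[OF this]
    show "pullback_metric (rotational_param (f \<circ> \<theta>) (h \<circ> \<theta>)) x = vector [vector [1, 0], vector [0, r]]"
      using pullback_metric_rotational_param_DERIV[OF fth[OF x] hth[OF x]] assms[OF th(1)[OF x]] by simp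
    show "r > 0" using r th(1)[OF x] by blast
  qed simp_all
  show ?thesis
    unfolding admits_harmonic_coordinate_fields_def
    using J harmonic_coordinate_field by (intro exI[of _ J] exI[of _ \<theta>]) simp
qed

text \<open>Taking \<open>f\<^sup>2\<close> as the new parameter \<open>u\<close> turns the metric into
  \<open>K / u du\<^sup>2 + u dv\<^sup>2\<close> with constant \<open>K\<close>.\<close>

lemma admits_harmonic_coordinate_fields_if_cone:
  assumes hf: "\<And>u. u \<in> I \<Longrightarrow> h u = m * f u + b"
  shows "admits_harmonic_coordinate_fields I f h"
proof -
  note f1 = smooth_on_realD(1)[OF I(1) f]
  have h': "deriv h u = m * deriv f u" if "u \<in> I" for u
  proof -
    have "((\<lambda>u. m * f u + b) has_field_derivative m * deriv f u) (at u)"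
      using f1[OF that] by (auto intro!: derivative_eq_intros)
    from has_field_derivative_transform_within_open[OF this I(1) that] show ?thesis
      using hf by (intro DERIV_imp_deriv) simp
  qed
  define F where "F u = (f u)\<^sup>2" for u
  have F: "smooth_on I F"
    unfolding F_def[abs_def] by (rule smooth_on_power2[OF I(1) f])
  have F': "deriv F u \<noteq> 0" if "u \<in> I" for u
  proof -
    have "(F has_field_derivative 2 * f u * deriv f u) (at u)"
      unfolding F_def[abs_def] using f1[OF that] by (auto intro!: derivative_eq_intros)
    then have "deriv F u = 2 * f u * deriv f u" by (rule DERIV_imp_deriv)
    moreover have "deriv f u \<noteq> 0" using reg[OF that] h'[OF that] by auto
    ultimately show ?thesis using f0[OF that] by simp
  qed
  define J \<theta> where "J = F ` I" and "\<theta> = inv_into I F"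
  have J: "open J" "is_interval J" "smooth_diffeomorphism J I \<theta>"
    unfolding J_def \<theta>_def using smooth_diffeomorphism_inv_into[OF I F] F' by blast+
  have dom: "x$1 \<in> J" if "x \<in> rotational_domain J" for x
    using that by (simp add: rotational_domain_def)
  have th: "\<theta> u \<in> I" "(f (\<theta> u))\<^sup>2 = u" if "u \<in> J" for u
    using that f_inv_into_f[of u F I] by (auto simp: J_def \<theta>_def inv_into_into F_def)
  have upos: "u > 0" if "u \<in> J" for u
    using th[OF that] f0 by (metis zero_less_power2)
  have fth: "((f \<circ> \<theta>) has_field_derivative 1 / (2 * f (\<theta> u))) (at u)" if "u \<in> J" for u
  proof -
    \<comment> \<open>The value of the derivative is found implicitly, by differentiating the
      identity \<open>f(\<theta>(u))^2 = u\<close>.\<close>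
    define d where "d = deriv (f \<circ> \<theta>) u"
    have d: "((f \<circ> \<theta>) has_field_derivative d) (at u)"
      unfolding d_def by (rule smooth_on_realD(1)[OF J(1) smooth_on_reparametrization(1)[OF J(1,3)] that])
    have "((\<lambda>u. ((f \<circ> \<theta>) u)\<^sup>2) has_field_derivative 2 * f (\<theta> u) * d) (at u)"
      using DERIV_power[OF d, of 2] by (simp add: mult_ac)
    moreover have "((\<lambda>u. ((f \<circ> \<theta>) u)\<^sup>2) has_field_derivative 1) (at u)"
      using has_field_derivative_transform_within_open[OF DERIV_ident J(1) that] th(2) by simp
    ultimately have "2 * f (\<theta> u) * d = 1" by (rule DERIV_unique)
    then have "d = 1 / (2 * f (\<theta> u))" using f0[OF th(1)[OF that]] by (simp add: field_simps)
    then show ?thesis using d by simp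
  qed
  have hth: "((h \<circ> \<theta>) has_field_derivative m * (1 / (2 * f (\<theta> u)))) (at u)" if "u \<in> J" for u
  proof -
    have "((\<lambda>u. m * (f \<circ> \<theta>) u + b) has_field_derivative m * (1 / (2 * f (\<theta> u)))) (at u)"
      using DERIV_add[OF DERIV_cmult[OF fth[OF that]] DERIV_const] by simp
    then show ?thesis
      by (rule has_field_derivative_transform_within_open[OF _ J(1) that]) (simp add: hf th(1))
  qed
  \<comment> \<open>In the new parameter \<open>f' = 1 / (2 * f)\<close> and
    \<open>h' = m * f'\<close>, so the squared speed is \<open>(1 + m^2) / (4 * f^2)\<close> with
    \<open>f^2 = u\<close>.\<close>
  define K where "K = (1 + m\<^sup>2) / 4"
  have K: "K > 0" by (simp add: K_def add_pos_nonneg)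
  \<comment> \<open>Here \<open>A = - C\<close> with \<open>C = 1 / (2 * u)\<close>, so both
    equations reduce to \<open>C' = - 2 * C^2\<close>.\<close>
  interpret warped_metric "rotational_domain J" "pullback_metric (rotational_param (f \<circ> \<theta>) (h \<circ> \<theta>))"
    "\<lambda>u. K / u" "\<lambda>u. u" "\<lambda>u. - 1 / (2 * u)" "\<lambda>u. 1 / (2 * u)" "\<lambda>u. 1 / (2 * u\<^sup>2)" "\<lambda>u. - 1 / (2 * u\<^sup>2)"
  proof
    show "open (rotational_domain J)" by (rule open_rotational_domain[OF J(1)])
    fix x assume "x \<in> rotational_domain J"
    note x = dom[OF this]
    have "(1 / (2 * f (\<theta> (x$1))))\<^sup>2 + (m * (1 / (2 * f (\<theta> (x$1)))))\<^sup>2 = K / x$1"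
      using th(2)[OF x] by (simp add: power_mult_distrib power_divide K_def add_divide_distrib)
    then show "pullback_metric (rotational_param (f \<circ> \<theta>) (h \<circ> \<theta>)) x =
        vector [vector [K / x$1, 0], vector [0, x$1]]"
      using pullback_metric_rotational_param_DERIV[OF fth[OF x] hth[OF x]] th(2)[OF x] by simp
    show "x$1 > 0" by (rule upos[OF x])
    then show "K / x$1 > 0" using K by simp
    show "((\<lambda>u. K / u) has_field_derivative 2 * (K / x$1) * (- 1 / (2 * x$1))) (at (x$1))"
      "((\<lambda>u. u) has_field_derivative 2 * x$1 * (1 / (2 * x$1))) (at (x$1))"
      "((\<lambda>u. - 1 / (2 * u)) has_field_derivative 1 / (2 * (x$1)\<^sup>2)) (at (x$1))"
      "((\<lambda>u. 1 / (2 * u)) has_field_derivative - 1 / (2 * (x$1)\<^sup>2)) (at (x$1))"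
      using \<open>x$1 > 0\<close> by (auto intro!: derivative_eq_intros simp: power2_eq_square)
  qed
  have "harmonic_section (rotational_domain J)
      (pullback_metric (rotational_param (f \<circ> \<theta>) (h \<circ> \<theta>))) (\<lambda>x. axis i 1)" for i
    using upos dom by (intro harmonic_coordinate_field) (fastforce simp: field_simps power2_eq_square)+
  then show ?thesis
    unfolding admits_harmonic_coordinate_fields_def
    using J by (intro exI[of _ J] exI[of _ \<theta>]) simp
qed

text \<open>The cone equation determines \<open>f\<close> only up to a sign that might vary with
  \<open>u\<close>. The quotient \<open>s\<close> is this sign: continuous on an interval because
  \<open>f\<close> has no zeros, hence constant.\<close>

lemma linear_relation_if_cone:
  assumes "I \<noteq> {}" "a \<noteq> 0" and cone: "\<And>u. u \<in> I \<Longrightarrow> (f u)\<^sup>2 = (a * h u + b)\<^sup>2"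
  obtains m c where "\<And>u. u \<in> I \<Longrightarrow> h u = m * f u + c"
proof -
  define s where "s u = (a * h u + b) / f u" for u
  have "s u \<in> {1, - 1}" if "u \<in> I" for u
    using cone[OF that] f0[OF that] by (auto simp: s_def power2_eq_iff divide_eq_eq)
  then have "finite (s ` I)"
    by (intro finite_subset[of "s ` I" "{1, - 1}"] image_subsetI) simp_all
  moreover have "continuous_on I s"
    using f[unfolded smooth_on_def, rule_format, of 0] h[unfolded smooth_on_def, rule_format, of 0] f0
    unfolding s_def[abs_def]
    by (intro continuous_on_divide continuous_on_add continuous_on_mult continuous_on_const) auto
  ultimately obtain s0 where s0: "\<And>u. u \<in> I \<Longrightarrow> s u = s0"
    using continuous_finite_range_constant[of I s] is_interval_connected[OF I(2)]
    unfolding constant_on_def by blast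
  have "h u = s0 / a * f u + - b / a" if "u \<in> I" for u
    using s0[OF that] f0[OF that] assms(2) by (simp add: s_def field_simps)
  then show thesis by (rule that)
qed

end

section \<open>Classification by the direction of the straight generatrix\<close>

theorem theorem3:
  fixes I :: "real set" and f h :: "real \<Rightarrow> real"
  assumes "open I" and "is_interval I" and "I \<noteq> {}"
    and "smooth_on I f" and "smooth_on I h"
    and "\<forall>u\<in>I. f u \<noteq> 0"
    and "\<forall>u\<in>I. (deriv f u)\<^sup>2 + (deriv h u)\<^sup>2 > 0"
  shows "admits_harmonic_coordinate_fields I f h \<longleftrightarrow>
      (\<exists>a. surface_of_revolution I f h \<subseteq> {p. p$3 = a}) \<or>
      (\<exists>a>0. surface_of_revolution I f h \<subseteq> {p. (p$1)\<^sup>2 + (p$2)\<^sup>2 = a\<^sup>2}) \<or>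
      (\<exists>a b. a \<noteq> 0 \<and> surface_of_revolution I f h \<subseteq> {p. (p$1)\<^sup>2 + (p$2)\<^sup>2 = (a * p$3 + b)\<^sup>2})"
    (is "?admits \<longleftrightarrow> ?plane \<or> ?cylinder \<or> ?cone")
proof
  note assms' = assms(1,2,4,5) bspec[OF assms(6)] bspec[OF assms(7)]
  note iff = surface_of_revolution_subset_iff[where I = I and f = f and h = h]
  obtain u0 where u0: "u0 \<in> I" using assms(3) by blast
  {
    assume ?admits
    then obtain k l c where kl: "k \<noteq> 0 \<or> l \<noteq> 0" and lin: "\<And>u. u \<in> I \<Longrightarrow> l * f u = k * h u + c"
      using linear_relation_if_admits_harmonic_coordinate_fields[OF assms' assms(3)] by blast
    \<comment> \<open>Differentiating the relation shows that \<open>(k, l)\<close> is parallel to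
      the tangent \<open>(f', h')\<close>: the line is orthogonal to the axis, parallel to it, or
      oblique.\<close>
    consider "l = 0" "k \<noteq> 0" | "l \<noteq> 0" "k = 0" | "l \<noteq> 0" "k \<noteq> 0" using kl by blast
    then show "?plane \<or> ?cylinder \<or> ?cone"
    proof cases
      case 1
      then have "\<forall>u\<in>I. h u = - c / k"
        using lin by (auto simp: field_simps add_eq_0_iff)
      then show ?thesis using iff(2) by blast
    next
      case 2
      then have fc: "f u = c / l" if "u \<in> I" for u
        using lin[OF that] by (simp add: field_simps)
      \<comment> \<open>The radius must be positive whereas \<open>f\<close> may be negative, hence
        the absolute value; it is nonzero since \<open>f\<close> does not vanish at
        \<open>u0\<close>.\<close>
      have "\<bar>c / l\<bar> > 0" using fc[OF u0] assms(6) u0 by auto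
      moreover have "\<forall>u\<in>I. (f u)\<^sup>2 = \<bar>c / l\<bar>\<^sup>2" using fc by (simp add: power2_abs del: abs_divide)
      ultimately show ?thesis using iff(1)[of "\<lambda>_. \<bar>c / l\<bar>\<^sup>2"] by blast
    next
      case 3
      then have "f u = k / l * h u + c / l" if "u \<in> I" for u
        using lin[OF that] by (simp add: field_simps)
      then have "\<forall>u\<in>I. (f u)\<^sup>2 = (k / l * h u + c / l)\<^sup>2"
        by simp
      then have "surface_of_revolution I f h \<subseteq> {p. (p$1)\<^sup>2 + (p$2)\<^sup>2 = (k / l * p$3 + c / l)\<^sup>2}"
        using iff(1)[of "\<lambda>z. (k / l * z + c / l)\<^sup>2"] by (simp only:)
      moreover have "k / l \<noteq> 0" using 3 by simp
      ultimately show ?thesis by blast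
    qed
  next
    assume "?plane \<or> ?cylinder \<or> ?cone"
    then consider (plane) a where "\<forall>u\<in>I. h u = a"
      | (cylinder) a where "\<forall>u\<in>I. (f u)\<^sup>2 = a\<^sup>2"
      | (cone) a b where "a \<noteq> 0" "\<forall>u\<in>I. (f u)\<^sup>2 = (a * h u + b)\<^sup>2"
      using iff(2) iff(1)[of "\<lambda>_. _\<^sup>2"] iff(1)[of "\<lambda>z. (_ * z + _)\<^sup>2"] by auto
    then show ?admits
    proof cases
      \<comment> \<open>A plane is treated as the degenerate cone whose generatrix
        \<open>h = m * f + b\<close> has slope 0.\<close>
      case plane
      then show ?thesis
        using admits_harmonic_coordinate_fields_if_cone[OF assms', where m = 0 and b = a] by simp
    next
      case cylinder
      then show ?thesis
        using admits_harmonic_coordinate_fields_if_cylinder[OF assms'] by blast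
    next
      case cone
      then obtain m c where "\<And>u. u \<in> I \<Longrightarrow> h u = m * f u + c"
        using linear_relation_if_cone[OF assms' assms(3), of a b] by blast
      then show ?thesis
        using admits_harmonic_coordinate_fields_if_cone[OF assms'] by blast
    qed
  }
qed

end
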